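(* For all integers $n\ge 0$, \[ a^{-\{1,2\}}_{4,1}(n)= a^{-\{1,2\}}_{4,3}(n). \]
   Context: A partition of $n$ is a non-increasing sequence of positive integers summing to $n$; its Young diagram is the left-justified array of boxes whose $i$-th row has $\lambda_i$ boxes. The hook length of a box is the number of boxes directly to its right, plus the number directly below it, plus $1$; a box of hook length $k$ is a $k$-hook. For $t\ge 2$, a $t$-core partition is a partition none of whose hook lengths is divisible by $t$. For a set $C$ of positive integers, $a^{-C}_{t,k}(n)$ denotes the total number of hooks of length $k$ summed over all $t$-core partitions of $n$ none of whose parts belongs to $C$. *)

theory Defs
  imports Main
begin

definition is_partition_of :: "nat list \<Rightarrow> nat \<Rightarrow> bool" where
  "is_partition_of ps n \<longleftrightarrow>
     sorted_wrt (\<ge>) ps \<and> (\<forall>p \<in> set ps. p > 0) \<and> sum_list ps = n"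

(* Boxes are pairs (row, column), both counted from 0. *)
definition young_diagram :: "nat list \<Rightarrow> (nat \<times> nat) set" where
  "young_diagram ps = {(i, j). i < length ps \<and> j < ps ! i}"

definition hook_length :: "nat list \<Rightarrow> nat \<times> nat \<Rightarrow> nat" where
  "hook_length ps = (\<lambda>(i, j).
     card {j'. j' > j \<and> (i, j') \<in> young_diagram ps}
     + card {i'. i' > i \<and> (i', j) \<in> young_diagram ps} + 1)"

definition is_core :: "nat \<Rightarrow> nat list \<Rightarrow> bool" where
  "is_core t ps \<longleftrightarrow> (\<forall>b \<in> young_diagram ps. \<not> t dvd hook_length ps b)"

definition num_hooks :: "nat \<Rightarrow> nat list \<Rightarrow> nat" where
  "num_hooks k ps = card {b \<in> young_diagram ps. hook_length ps b = k}"

definition core_partitions_avoiding :: "nat set \<Rightarrow> nat \<Rightarrow> nat \<Rightarrow> nat list set" where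
  "core_partitions_avoiding C t n =
     {ps. is_partition_of ps n \<and> is_core t ps \<and> set ps \<inter> C = {}}"

(* This is a^{-C}_{t,k}(n). *)
definition core_hooks_avoiding :: "nat set \<Rightarrow> nat \<Rightarrow> nat \<Rightarrow> nat \<Rightarrow> nat" where
  "core_hooks_avoiding C t k n = (\<Sum>ps \<in> core_partitions_avoiding C t n. num_hooks k ps)"

(* The sets under card and sum above are finite, so neither is degenerately 0. *)

lemma finite_young_diagram: "finite (young_diagram ps)"
proof -
  have "young_diagram ps = (SIGMA i:{..<length ps}. {..<ps ! i})"
    by (auto simp: young_diagram_def)
  then show ?thesis by simp
qed

lemma finite_arm: "finite {j'. j' > j \<and> (i, j') \<in> young_diagram ps}"
  by (rule finite_subset[of _ "snd ` young_diagram ps"]) (force simp: finite_young_diagram)+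

lemma finite_leg: "finite {i'. i' > i \<and> (i', j) \<in> young_diagram ps}"
  by (rule finite_subset[of _ "fst ` young_diagram ps"]) (force simp: finite_young_diagram)+

lemma finite_partitions: "finite {ps. is_partition_of ps n}"
proof (rule finite_subset)
  have len: "length xs \<le> sum_list xs" if "\<forall>p \<in> set xs. p > 0" for xs :: "nat list"
    using that by (induction xs) auto
  show "{ps. is_partition_of ps n} \<subseteq> {xs. set xs \<subseteq> {..n} \<and> length xs \<le> n}"
    using len by (auto simp: is_partition_of_def member_le_sum_list)
  show "finite {xs. set xs \<subseteq> {..n} \<and> length xs \<le> n}"
    by (rule finite_lists_length_le) simp
qed

lemma finite_core_partitions_avoiding: "finite (core_partitions_avoiding C t n)"
  by (rule finite_subset[OF _ finite_partitions[of n]])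
     (auto simp: core_partitions_avoiding_def)

end

(*
  A 4-core without parts 1 and 2 must be a staircase (3k, 3(k-1), ..., 6, 3): adding a row of length
  p >= 3k on top of a staircase with k rows creates the hook length p - j + k - j div 3 in column j,
  and some value of it is a multiple of 4 unless p = 3k + 3. In that case the values in the new row
  are 4(k - q) + 3 - r at column 3q + r, so the row contributes exactly one 1-hook (q = k, r = 2)
  and exactly one 3-hook (q = k, r = 0).
*)
theory Submission
  imports Defs
begin

lemma young_diagram_Cons:
  "young_diagram (p # ps) = Pair 0 ` {..<p} \<union> map_prod Suc id ` young_diagram ps"
proof (rule set_eqI)
  fix b :: "nat \<times> nat"
  obtain i j where b: "b = (i, j)" by fastforce
  show "b \<in> young_diagram (p # ps) \<longleftrightarrow>
      b \<in> Pair 0 ` {..<p} \<union> map_prod Suc id ` young_diagram ps"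
    by (cases i) (auto simp: b young_diagram_def image_iff)
qed

lemma Suc_in_young_diagram_Cons [simp]:
  "(Suc i, j) \<in> young_diagram (p # ps) \<longleftrightarrow> (i, j) \<in> young_diagram ps"
  by (simp add: young_diagram_def)

text \<open>Arms and legs extend only right and down, so a new top row changes no hook below it.
  Hence cores and hook counts can be treated row by row, by induction on the list.\<close>

lemma hook_length_Cons_Suc [simp]: "hook_length (p # ps) (Suc i, j) = hook_length ps (i, j)"
proof -
  have "{i'. i' > Suc i \<and> (i', j) \<in> young_diagram (p # ps)} =
      Suc ` {i'. i' > i \<and> (i', j) \<in> young_diagram ps}"
    by (auto simp: image_iff gr0_conv_Suc Suc_less_eq2)
  then show ?thesis
    by (simp add: hook_length_def card_image)
qed

lemma hook_length_Cons_0: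
  assumes "j < p"
  shows "hook_length (p # ps) (0, j) = p - j + card {i. i < length ps \<and> j < ps ! i}"
proof -
  have arm: "{j'. j' > j \<and> (0, j') \<in> young_diagram (p # ps)} = {j<..<p}"
    by (auto simp: young_diagram_def)
  have leg: "{i'. i' > 0 \<and> (i', j) \<in> young_diagram (p # ps)} =
      Suc ` {i. i < length ps \<and> j < ps ! i}"
    by (auto simp: image_iff gr0_conv_Suc young_diagram_def)
  show ?thesis
    using assms by (simp add: hook_length_def arm leg card_image)
qed

lemma is_core_ConsD: "is_core t (p # ps) \<Longrightarrow> is_core t ps"
  by (force simp: is_core_def young_diagram_Cons)

lemma num_hooks_Cons:
  "num_hooks k (p # ps) = card {j. j < p \<and> hook_length (p # ps) (0, j) = k} + num_hooks k ps"
proof -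
  let ?A = "{j. j < p \<and> hook_length (p # ps) (0, j) = k}"
  let ?B = "{b \<in> young_diagram ps. hook_length ps b = k}"
  have "{b \<in> young_diagram (p # ps). hook_length (p # ps) b = k} =
      Pair 0 ` ?A \<union> map_prod Suc id ` ?B"
    by (force simp: young_diagram_Cons)
  moreover have "card (Pair (0::nat) ` ?A \<union> map_prod Suc id ` ?B) =
      card (Pair (0::nat) ` ?A) + card (map_prod Suc id ` ?B)"
    by (rule card_Un_disjoint) (auto simp: finite_young_diagram)
  moreover have "inj_on (map_prod Suc id) ?B"
    by (auto simp: inj_on_def)
  ultimately show ?thesis
    by (simp add: num_hooks_def card_image inj_on_def)
qed

fun staircase :: "nat \<Rightarrow> nat list" where
  "staircase 0 = []"
| "staircase (Suc k) = 3 * Suc k # staircase k"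

lemma length_staircase [simp]: "length (staircase k) = k"
  by (induction k) auto

lemma nth_staircase: "i < k \<Longrightarrow> staircase k ! i = 3 * (k - i)"
  by (induction k arbitrary: i) (auto simp: nth_Cons split: nat.split)

lemma hook_length_Cons_staircase:
  assumes "j < p"
  shows "hook_length (p # staircase k) (0, j) = p - j + (k - j div 3)"
proof -
  \<comment> \<open>Row \<open>i\<close> reaches column \<open>j\<close> iff j < 3(k - i), that is,
    iff j div 3 < k - i.\<close>
  have "{i. i < k \<and> j < staircase k ! i} = {..<k - j div 3}"
    by (auto simp: nth_staircase)
  then show ?thesis
    using assms by (simp add: hook_length_Cons_0)
qed

lemma four_core_eq_staircase:
  assumes "sorted_wrt (\<ge>) ps" "\<forall>p \<in> set ps. p \<ge> 3" "is_core 4 ps"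
  shows "ps = staircase (length ps)"
  using assms
proof (induction ps)
  case Nil
  then show ?case by simp
next
  case (Cons p ps)
  define k where "k = length ps"
  have ps: "ps = staircase k"
    using Cons is_core_ConsD by (auto simp: k_def)
  \<comment> \<open>For k > 0 the second bound is sortedness against \<open>3 * k\<close>, the head
    of \<open>staircase k\<close>.\<close>
  have p_ge: "p \<ge> 3" "p \<ge> 3 * k"
    using Cons.prems ps by (cases k; simp)+
  have core: "\<not> 4 dvd p - j + (k - j div 3)" if "j < p" for j
    using Cons.prems(3) that hook_length_Cons_staircase[OF that, of k]
    by (force simp: is_core_def ps young_diagram_Cons)
  have "p \<le> 3 * k + 3"
  proof (rule ccontr)
    assume "\<not> p \<le> 3 * k + 3"
    \<comment> \<open>Column \<open>p - 4\<close> is at least \<open>3 * k\<close>, so it has no box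
      below the new row, and the arm alone gives a 4-hook.\<close>
    then have "p - 4 < p" "p - (p - 4) + (k - (p - 4) div 3) = 4"
      by auto
    then show False
      using core[of "p - 4"] by simp
  qed
  moreover have "\<not> p < 3 * k + 3"
  proof
    assume less: "p < 3 * k + 3"
    \<comment> \<open>Here d < 3, so column \<open>d\<close> meets all \<open>k\<close> lower rows
      and its hook length is 3k + k. The case k = 0, where \<open>d\<close> would equal
      \<open>p\<close>, is excluded by p \<ge> 3.\<close>
    define d where "d = p - 3 * k"
    have "d < p" "p - d + (k - d div 3) = 4 * k"
      using less p_ge by (auto simp: d_def)
    then show False
      using core[of d] by simp
  qed
  ultimately have "p = 3 * Suc k"
    by simp
  then show ?case
    by (simp add: ps)
qed

lemma num_hooks_staircase: "num_hooks 1 (staircase k) = k" "num_hooks 3 (staircase k) = k"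
proof (induction k)
  case (Suc k)
  let ?h = "\<lambda>j. hook_length (3 * Suc k # staircase k) (0, j)"
  have h: "?h j = 3 * Suc k - j + (k - j div 3)" if "j < 3 * Suc k" for j
    using that by (rule hook_length_Cons_staircase)
  have "?h j = 1 \<longleftrightarrow> j = 3 * k + 2" "?h j = 3 \<longleftrightarrow> j = 3 * k" if "j < 3 * Suc k" for j
  proof -
    define q r where "q = j div 3" and "r = j mod 3"
    have j: "j = 3 * q + r" "r < 3"
      by (simp_all add: q_def r_def)
    \<comment> \<open>Replacing \<open>k - q\<close> by \<open>m\<close> removes the truncated
      subtraction.\<close>
    with that obtain m where k: "k = q + m"
      using le_Suc_ex[of q k] by auto
    have "?h j = 3 - r + 4 * m"
      using j k h[OF that] by (simp flip: q_def)
    \<comment> \<open>Since 3 - r is 1, 2 or 3, the values 1 and 3 force m = 0, leaving only the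
      last three columns.\<close>
    then show "?h j = 1 \<longleftrightarrow> j = 3 * k + 2" "?h j = 3 \<longleftrightarrow> j = 3 * k"
      using j k by auto
  qed
  moreover have "3 * k + 2 < 3 * Suc k" "3 * k < 3 * Suc k"
    by simp_all
  ultimately have "{j. j < 3 * Suc k \<and> ?h j = 1} = {3 * k + 2}"
      "{j. j < 3 * Suc k \<and> ?h j = 3} = {3 * k}"
    by blast+
  then show "num_hooks 1 (staircase (Suc k)) = Suc k"
      "num_hooks 3 (staircase (Suc k)) = Suc k"
    \<comment> \<open>The restricted first pass keeps \<open>3 * Suc k\<close> intact, so that the
      two set equations still match.\<close>
    using Suc by (simp_all only: staircase.simps num_hooks_Cons card.insert) simp_all
qed (simp_all add: num_hooks_def young_diagram_def)

theorem theorem1p6: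
  fixes n :: nat
  shows "core_hooks_avoiding {1, 2} 4 1 n = core_hooks_avoiding {1, 2} 4 3 n"
  unfolding core_hooks_avoiding_def
\<comment> \<open>The sums agree term by term: in each partition both counts equal the number of
  parts.\<close>
proof (rule sum.cong)
  fix ps assume "ps \<in> core_partitions_avoiding {1, 2} 4 n"
  then have ps: "sorted_wrt (\<ge>) ps" "\<forall>p \<in> set ps. p > 0" "is_core 4 ps" "1 \<notin> set ps" "2 \<notin> set ps"
    by (auto simp: core_partitions_avoiding_def is_partition_of_def)
  have "p \<ge> 3" if "p \<in> set ps" for p
  proof -
    have "p \<noteq> 0" "p \<noteq> 1" "p \<noteq> 2"
      using ps that by auto
    then show ?thesis by linarith
  qed
  then have "ps = staircase (length ps)"
    using ps four_core_eq_staircase by blast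
  then show "num_hooks 1 ps = num_hooks 3 ps"
    by (metis num_hooks_staircase)
qed simp

end
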